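(* Let $m,n\ge 2$ be integers. The word problem in the group $G_{m,n}$, given by its presentation, is solvable: there is an algorithm which, given two words in the generators and their inverses, decides whether they represent the same element of $G_{m,n}$.
   Context: For letters $x_1,\dots,x_k$, the symbol $[x_1,x_2,\dots,x_k]$ denotes the cyclic relations $x_1x_2\cdots x_k=x_2\cdots x_kx_1=x_3\cdots x_kx_1x_2=\cdots=x_kx_1\cdots x_{k-1}$ (all cyclic rotations of the word are equal); in particular $[x,y]$ denotes $xy=yx$. $G_{m,n}$ is the group presented by the generators $s,t_1,\dots,t_m,u_1,\dots,u_n$ and the relations $[s,t_1,\dots,t_m]$, $[s,u_1,\dots,u_n]$, and $[t_i,u_j]$ for all $1\le i\le m$, $1\le j\le n$. *)

theory Defs
  imports "HOL-Algebra.Group" "HOL-Library.Nat_Bijection"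
begin

section \<open>Group presentations\<close>

text \<open>The letter \<open>(x, True)\<close> stands for the generator \<open>x\<close>, the letter \<open>(x, False)\<close> for its
  formal inverse.\<close>

type_synonym 'a word = "('a \<times> bool) list"

definition words :: "'a set \<Rightarrow> 'a word set" where
  "words X = lists (X \<times> UNIV)"

text \<open>A relation \<open>l = r\<close> is given by the pair \<open>(l, r)\<close> of words. Equality in the presented group is
  the smallest equivalence relation on words allowing free cancellation and replacement of \<open>l\<close>
  by \<open>r\<close> inside any word; it is automatically a congruence for concatenation.\<close>

inductive pres_eq :: "'a set \<Rightarrow> ('a word \<times> 'a word) set \<Rightarrow> 'a word \<Rightarrow> 'a word \<Rightarrow> bool"
  for X :: "'a set" and R :: "('a word \<times> 'a word) set" where
  refl: "w \<in> words X \<Longrightarrow> pres_eq X R w w"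
| sym: "pres_eq X R v w \<Longrightarrow> pres_eq X R w v"
| trans: "pres_eq X R u v \<Longrightarrow> pres_eq X R v w \<Longrightarrow> pres_eq X R u w"
| cancel: "u \<in> words X \<Longrightarrow> v \<in> words X \<Longrightarrow> x \<in> X \<Longrightarrow>
    pres_eq X R (u @ [(x, b), (x, \<not> b)] @ v) (u @ v)"
| relation: "u \<in> words X \<Longrightarrow> v \<in> words X \<Longrightarrow> (l, r) \<in> R \<Longrightarrow>
    pres_eq X R (u @ l @ v) (u @ r @ v)"

definition element :: "'a set \<Rightarrow> ('a word \<times> 'a word) set \<Rightarrow> 'a word \<Rightarrow> 'a word set" where
  "element X R w = {v. pres_eq X R w v}"

definition presented_group ::
  "'a set \<Rightarrow> ('a word \<times> 'a word) set \<Rightarrow> 'a word set monoid" where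
  "presented_group X R =
    \<lparr>carrier = element X R ` words X,
     mult = (\<lambda>A B. \<Union>a\<in>A. \<Union>b\<in>B. element X R (a @ b)),
     one = element X R []\<rparr>"

lemma append_in_words: "u @ v \<in> words X \<longleftrightarrow> u \<in> words X \<and> v \<in> words X"
  by (auto simp: words_def)

lemma pres_eq_append:
  assumes "pres_eq X R v w" "a \<in> words X" "b \<in> words X"
  shows "pres_eq X R (a @ v @ b) (a @ w @ b)"
  using assms
proof (induction rule: pres_eq.induct)
  case (refl w)
  then show ?case by (auto intro: pres_eq.refl simp: append_in_words)
next
  case (sym v w)
  then show ?case by (blast intro: pres_eq.sym)
next
  case (trans u v w)
  then show ?case by (blast intro: pres_eq.trans)
next
  case (cancel u v x c)
  then show ?case
    using pres_eq.cancel[of "a @ u" X "v @ b" x R c] by (simp add: append_in_words)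
next
  case (relation u v l r)
  then show ?case
    using pres_eq.relation[of "a @ u" X "v @ b" l r R] by (simp add: append_in_words)
qed

lemma pres_eq_in_words:
  assumes "pres_eq X R v w" "R \<subseteq> words X \<times> words X"
  shows "v \<in> words X \<and> w \<in> words X"
  using assms by (induction rule: pres_eq.induct) (auto simp: append_in_words words_def)

lemma element_eq_iff:
  assumes "w \<in> words X"
  shows "element X R v = element X R w \<longleftrightarrow> pres_eq X R v w"
proof
  assume "element X R v = element X R w"
  then have "w \<in> element X R v" using assms by (simp add: element_def pres_eq.refl)
  then show "pres_eq X R v w" by (simp add: element_def)
next
  assume vw: "pres_eq X R v w"
  have "pres_eq X R v u \<longleftrightarrow> pres_eq X R w u" for u
    using pres_eq.trans[OF vw] pres_eq.trans[OF pres_eq.sym[OF vw]] by blast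
  then show "element X R v = element X R w" by (simp add: element_def)
qed

lemma element_mult:
  assumes R: "R \<subseteq> words X \<times> words X" and v: "v \<in> words X" and w: "w \<in> words X"
  shows "element X R v \<otimes>\<^bsub>presented_group X R\<^esub> element X R w = element X R (v @ w)"
proof -
  have "element X R (a @ b) = element X R (v @ w)"
    if "pres_eq X R v a" "pres_eq X R w b" for a b
  proof -
    have ab: "a \<in> words X" "b \<in> words X"
      using that pres_eq_in_words[OF _ R] by blast+
    have "pres_eq X R (v @ w) (a @ w)" "pres_eq X R (a @ w) (a @ b)"
      using pres_eq_append[OF that(1), of "[]" w] pres_eq_append[OF that(2), of a "[]"] w ab
      by (auto simp: words_def)
    then have "element X R (v @ w) = element X R (a @ b)"
      using ab w element_eq_iff[of "a @ w" X R "v @ w"] element_eq_iff[of "a @ b" X R "a @ w"]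
      by (simp add: append_in_words)
    then show ?thesis by simp
  qed
  then have eq: "element X R (a @ b) = element X R (v @ w)"
    if "a \<in> element X R v" "b \<in> element X R w" for a b
    using that by (simp add: element_def)
  have "v \<in> element X R v" "w \<in> element X R w"
    using v w by (simp_all add: element_def pres_eq.refl)
  then have "(\<Union>a\<in>element X R v. \<Union>b\<in>element X R w. element X R (a @ b)) = element X R (v @ w)"
    using eq by blast
  then show ?thesis by (simp add: presented_group_def)
qed

lemma pres_eq_inverse:
  assumes "w \<in> words X"
  shows "pres_eq X R (rev (map (apsnd Not) w) @ w) []"
  using assms
proof (induction w)
  case Nil
  then show ?case by (auto intro: pres_eq.refl)
next
  case (Cons p w)
  obtain x b where p: "p = (x, b)" by force
  let ?u = "rev (map (apsnd Not) w)"
  have in_words: "x \<in> X" "w \<in> words X" "?u \<in> words X"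
    using Cons.prems p by (fastforce simp: words_def)+
  have "pres_eq X R (?u @ [(x, \<not> b), (x, b)] @ w) (?u @ w)"
    using pres_eq.cancel[OF in_words(3,2,1), of R "\<not> b"] by simp
  from pres_eq.trans[OF this Cons.IH[OF in_words(2)]] show ?case using p by simp
qed

lemma group_presented_group:
  assumes R: "R \<subseteq> words X \<times> words X"
  shows "group (presented_group X R)"
proof (rule groupI)
  let ?G = "presented_group X R"
  have carrier: "carrier ?G = element X R ` words X" and one: "\<one>\<^bsub>?G\<^esub> = element X R []"
    by (simp_all add: presented_group_def)
  have Nil: "[] \<in> words X" by (simp add: words_def)
  show "x \<otimes>\<^bsub>?G\<^esub> y \<in> carrier ?G" if "x \<in> carrier ?G" "y \<in> carrier ?G" for x y
    using that by (auto simp: carrier element_mult[OF R] append_in_words)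
  show "\<one>\<^bsub>?G\<^esub> \<in> carrier ?G" using Nil by (simp add: carrier one)
  show "x \<otimes>\<^bsub>?G\<^esub> y \<otimes>\<^bsub>?G\<^esub> z = x \<otimes>\<^bsub>?G\<^esub> (y \<otimes>\<^bsub>?G\<^esub> z)"
    if "x \<in> carrier ?G" "y \<in> carrier ?G" "z \<in> carrier ?G" for x y z
    using that by (auto simp: carrier element_mult[OF R] append_in_words)
  show "\<one>\<^bsub>?G\<^esub> \<otimes>\<^bsub>?G\<^esub> x = x" if "x \<in> carrier ?G" for x
    using that Nil by (auto simp: carrier one element_mult[OF R])
  show "\<exists>y\<in>carrier ?G. y \<otimes>\<^bsub>?G\<^esub> x = \<one>\<^bsub>?G\<^esub>" if x: "x \<in> carrier ?G" for x
  proof -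
    obtain w where w: "w \<in> words X" "x = element X R w" using x by (auto simp: carrier)
    let ?v = "rev (map (apsnd Not) w)"
    have v: "?v \<in> words X" using w(1) by (fastforce simp: words_def)
    have "element X R ?v \<otimes>\<^bsub>?G\<^esub> x = \<one>\<^bsub>?G\<^esub>"
      using pres_eq_inverse[OF w(1)] by (simp add: w(2) one element_mult[OF R v w(1)] element_eq_iff[OF Nil])
    then show ?thesis using v by (auto simp: carrier)
  qed
qed


section \<open>Solvability of the word problem\<close>

text \<open>The total recursive functions of arity \<open>k\<close>, with arguments passed as a list of length \<open>k\<close>
  (values on lists of any other length are irrelevant): the smallest class
  containing zero, successor and projections, and closed under composition, primitive recursion
  and minimization of regular functions.\<close>

inductive total_recursive :: "nat \<Rightarrow> (nat list \<Rightarrow> nat) \<Rightarrow> bool" where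
  zero: "total_recursive k (\<lambda>xs. 0)"
| succ: "total_recursive 1 (\<lambda>xs. Suc (xs ! 0))"
| proj: "i < k \<Longrightarrow> total_recursive k (\<lambda>xs. xs ! i)"
| comp: "total_recursive (length hs) g \<Longrightarrow> (\<forall>h\<in>set hs. total_recursive k h) \<Longrightarrow>
    total_recursive k (\<lambda>xs. g (map (\<lambda>h. h xs) hs))"
| prim_rec: "total_recursive k g \<Longrightarrow> total_recursive (Suc (Suc k)) h \<Longrightarrow>
    total_recursive (Suc k) (\<lambda>xs. rec_nat (g (tl xs)) (\<lambda>y r. h (y # r # tl xs)) (hd xs))"
| minim: "total_recursive (Suc k) g \<Longrightarrow> (\<forall>xs. length xs = k \<longrightarrow> (\<exists>y. g (y # xs) = 0)) \<Longrightarrow>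
    total_recursive k (\<lambda>xs. LEAST y. g (y # xs) = 0)"

text \<open>Goedel numbering of words, relative to a numbering \<open>num\<close> of the generators.\<close>

definition word_code :: "('a \<Rightarrow> nat) \<Rightarrow> 'a word \<Rightarrow> nat" where
  "word_code num w = list_encode (map (\<lambda>(x, b). 2 * num x + (if b then 0 else 1)) w)"

lemma inj_word_code:
  assumes "inj num"
  shows "inj (word_code num)"
proof -
  have "inj (\<lambda>(x, b). 2 * num x + (if b then 0 else 1 :: nat))"
  proof (rule injI, clarify)
    fix x y b c
    assume "2 * num x + (if b then 0 else 1 :: nat) = 2 * num y + (if c then 0 else 1)"
    then have "num x = num y \<and> b = c" by (cases b; cases c; simp; presburger)
    then show "x = y \<and> b = c" using assms by (auto dest: injD)
  qed
  then have "inj (map (\<lambda>(x, b). 2 * num x + (if b then 0 else 1 :: nat)))"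
    by (rule inj_mapI)
  then show ?thesis by (auto simp: inj_def word_code_def list_encode_eq)
qed

text \<open>Only meaningful for an injective numbering \<open>num\<close> of the generators.\<close>

definition word_problem_solvable ::
  "('a \<Rightarrow> nat) \<Rightarrow> 'a set \<Rightarrow> ('a word \<times> 'a word) set \<Rightarrow> bool" where
  "word_problem_solvable num X R \<longleftrightarrow>
    (\<exists>f. total_recursive 2 f \<and>
      (\<forall>v\<in>words X. \<forall>w\<in>words X.
        f [word_code num v, word_code num w] =
          (if element X R v = element X R w then 1 else 0)))"


section \<open>The groups \<open>G\<^sub>m\<^sub>,\<^sub>n\<close>\<close>

definition cyclic_relations :: "'a list \<Rightarrow> ('a word \<times> 'a word) set" where
  "cyclic_relations xs =
    {(map (\<lambda>x. (x, True)) (rotate i xs), map (\<lambda>x. (x, True)) (rotate j xs)) | i j.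
      i < length xs \<and> j < length xs}"

datatype gen = S | T nat | U nat

fun gen_num :: "gen \<Rightarrow> nat" where
  "gen_num S = 0"
| "gen_num (T i) = 2 * i + 1"
| "gen_num (U j) = 2 * j + 2"

definition G_gens :: "nat \<Rightarrow> nat \<Rightarrow> gen set" where
  "G_gens m n = {S} \<union> T ` {1..m} \<union> U ` {1..n}"

definition G_rels :: "nat \<Rightarrow> nat \<Rightarrow> (gen word \<times> gen word) set" where
  "G_rels m n =
    cyclic_relations (S # map T [1..<Suc m]) \<union>
    cyclic_relations (S # map U [1..<Suc n]) \<union>
    (\<Union>i\<in>{1..m}. \<Union>j\<in>{1..n}. cyclic_relations [T i, U j])"

definition G :: "nat \<Rightarrow> nat \<Rightarrow> gen word set monoid" where
  "G m n = presented_group (G_gens m n) (G_rels m n)"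

lemma inj_gen_num: "inj gen_num"
proof (rule injI)
  fix x y
  assume "gen_num x = gen_num y"
  then show "x = y" by (cases x; cases y; simp; presburger)
qed

lemma cyclic_relations_in_words:
  "set xs \<subseteq> X \<Longrightarrow> cyclic_relations xs \<subseteq> words X \<times> words X"
  by (auto simp: cyclic_relations_def words_def)

lemma G_rels_in_words: "G_rels m n \<subseteq> words (G_gens m n) \<times> words (G_gens m n)"
  unfolding G_rels_def
  by (intro Un_least UN_least cyclic_relations_in_words) (auto simp: G_gens_def)

lemma group_G: "group (G m n)"
  unfolding G_def by (rule group_presented_group[OF G_rels_in_words])

end

theory Submission
  imports Defs
begin

text \<open>
  Put \<open>P = t\<^sub>1\<cdots>t\<^sub>m\<close> and \<open>Q = u\<^sub>1\<cdots>u\<^sub>n\<close>. The relations \<open>[s, t\<^sub>1, \<dots>, t\<^sub>m]\<close> say that \<open>s P\<close> commutes with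
  \<open>s\<close> and with every \<open>t\<^sub>i\<close>, and likewise for \<open>s Q\<close>. Since the \<open>t\<^sub>i\<close> commute with the \<open>u\<^sub>j\<close>, the
  element \<open>z = s P Q\<close> is central, and \<open>s = P\<^sup>-\<^sup>1 Q\<^sup>-\<^sup>1 z\<close>. Hence the group is the direct
  product of the free groups on the \<open>t\<^sub>i\<close>, on the \<open>u\<^sub>j\<close> and on \<open>z\<close>, and two words are equal in it iff
  their three projections, each obtained by substituting words for the generators, are freely equal.
  Free reduction with a stack is primitive recursive, which decides this.
\<close>

section \<open>Words in presented groups\<close>

definition inverse_word :: "'a word \<Rightarrow> 'a word" where
  "inverse_word w = rev (map (apsnd Not) w)"

text \<open>The homomorphism of free groups that extends \<open>f\<close>, computed on words without
  any cancellation.\<close>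

definition substitute :: "('a \<Rightarrow> 'b word) \<Rightarrow> 'a word \<Rightarrow> 'b word" where
  "substitute f w = concat (map (\<lambda>(x, b). if b then f x else inverse_word (f x)) w)"

lemma flip_flip [simp]: "apsnd Not (apsnd Not a) = a"
  by (cases a) simp

lemma inverse_word_simps [simp]:
  "inverse_word [] = []"
  "inverse_word (u @ v) = inverse_word v @ inverse_word u"
  "inverse_word (inverse_word w) = w"
  by (simp_all add: inverse_word_def rev_map comp_def)

lemma substitute_simps [simp]:
  "substitute f [] = []"
  "substitute f ((x, True) # w) = f x @ substitute f w"
  "substitute f ((x, False) # w) = inverse_word (f x) @ substitute f w"
  "substitute f (v @ w) = substitute f v @ substitute f w"
  by (simp_all add: substitute_def)

lemma substitute_positive: "substitute f (map (\<lambda>x. (x, True)) xs) = concat (map f xs)"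
  by (induction xs) simp_all

lemma inverse_word_substitute: "inverse_word (substitute f w) = substitute f (inverse_word w)"
  by (induction w) (auto simp: substitute_def inverse_word_def comp_def rev_map)

lemma substitute_substitute:
  "substitute g (substitute f w) = substitute (\<lambda>x. substitute g (f x)) w"
  by (induction w) (auto simp: substitute_def inverse_word_substitute[unfolded substitute_def, symmetric]
      split: prod.splits)

lemma words_simps [simp]:
  "[] \<in> words X"
  "(a # w) \<in> words X \<longleftrightarrow> fst a \<in> X \<and> w \<in> words X"
  "u @ v \<in> words X \<longleftrightarrow> u \<in> words X \<and> v \<in> words X"
  "rev w \<in> words X \<longleftrightarrow> w \<in> words X"
  "map (\<lambda>x. (x, True)) xs \<in> words X \<longleftrightarrow> set xs \<subseteq> X"
  by (cases a; auto simp: words_def)+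

lemma inverse_word_in_words [simp]: "inverse_word w \<in> words X \<longleftrightarrow> w \<in> words X"
  by (induction w) (auto simp: inverse_word_def)

lemma substitute_in_words:
  "w \<in> words X \<Longrightarrow> (\<And>x. x \<in> X \<Longrightarrow> f x \<in> words Y) \<Longrightarrow> substitute f w \<in> words Y"
  by (induction w) (auto simp: substitute_def)

lemma substitute_generators: "substitute (\<lambda>x. [(x, True)]) w = w"
  by (induction w) (auto simp: substitute_def inverse_word_def)

lemma pres_eq_cong:
  assumes R: "R \<subseteq> words X \<times> words X" and "pres_eq X R u u'" "pres_eq X R v v'"
  shows "pres_eq X R (u @ v) (u' @ v')"
proof -
  have "u' \<in> words X" "v \<in> words X"
    using assms pres_eq_in_words[OF _ R] by blast+
  then show ?thesis
    using pres_eq_append[OF assms(2), of "[]" v] pres_eq_append[OF assms(3), of u' "[]"]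
    by (auto intro: pres_eq.trans)
qed

lemma pres_eq_left_inverse: "w \<in> words X \<Longrightarrow> pres_eq X R (inverse_word w @ w) []"
  using pres_eq_inverse by (simp add: inverse_word_def)

lemma pres_eq_right_inverse: "w \<in> words X \<Longrightarrow> pres_eq X R (w @ inverse_word w) []"
  using pres_eq_left_inverse[of "inverse_word w"] by simp

text \<open>The chain is v^-1 = v^-1 w w^-1 = v^-1 v w^-1 = w^-1.\<close>

lemma pres_eq_inverse_cong:
  assumes R: "R \<subseteq> words X \<times> words X" and eq: "pres_eq X R v w"
  shows "pres_eq X R (inverse_word v) (inverse_word w)"
proof -
  have vw: "v \<in> words X" "w \<in> words X" using pres_eq_in_words[OF eq R] by auto
  have "pres_eq X R (inverse_word v) (inverse_word v @ w @ inverse_word w)"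
    using vw pres_eq_append[OF pres_eq_right_inverse[OF vw(2), of R], of "inverse_word v" "[]"]
    by (auto intro: pres_eq.sym)
  moreover have "pres_eq X R (inverse_word v @ w @ inverse_word w) (inverse_word v @ v @ inverse_word w)"
    using vw pres_eq_append[OF pres_eq.sym[OF eq], of "inverse_word v" "inverse_word w"] by simp
  moreover have "pres_eq X R (inverse_word v @ v @ inverse_word w) (inverse_word w)"
    using vw pres_eq_append[OF pres_eq_left_inverse[OF vw(1), of R], of "[]" "inverse_word w"] by simp
  ultimately show ?thesis by (blast intro: pres_eq.trans)
qed

text \<open>A conjugate of the identity is trivial: v u = v (u v) v^-1.\<close>

lemma pres_eq_rotate_Nil:
  assumes R: "R \<subseteq> words X \<times> words X" and uv: "pres_eq X R (u @ v) []"
  shows "pres_eq X R (v @ u) []"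
proof -
  have w: "u \<in> words X" "v \<in> words X" using pres_eq_in_words[OF uv R] by auto
  have "pres_eq X R (v @ u) (v @ u @ v @ inverse_word v)"
    using w pres_eq_append[OF pres_eq_right_inverse[OF w(2), of R], of "v @ u" "[]"]
    by (auto intro: pres_eq.sym)
  moreover have "pres_eq X R (v @ u @ v @ inverse_word v) (v @ inverse_word v)"
    using w pres_eq_append[OF uv, of v "inverse_word v"] by simp
  ultimately show ?thesis
    using pres_eq_right_inverse[OF w(2), of R] by (blast intro: pres_eq.trans)
qed

text \<open>Von Dyck's principle: a map on generators that respects the relations induces a
  homomorphism. It serves both for projecting to free groups and for mapping the free factor on z
  back into the group.\<close>

lemma pres_eq_substitute:
  assumes R': "R' \<subseteq> words Y \<times> words Y" and f: "\<And>x. x \<in> X \<Longrightarrow> f x \<in> words Y"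
    and rel: "\<And>l r. (l, r) \<in> R \<Longrightarrow> pres_eq Y R' (substitute f l) (substitute f r)"
    and eq: "pres_eq X R v w"
  shows "pres_eq Y R' (substitute f v) (substitute f w)"
  using eq
proof (induction rule: pres_eq.induct)
  case (refl w)
  then show ?case using f by (auto intro: pres_eq.refl substitute_in_words)
next
  case (sym v w)
  then show ?case by (blast intro: pres_eq.sym)
next
  case (trans u v w)
  then show ?case by (blast intro: pres_eq.trans)
next
  case (cancel u v x b)
  have uv: "substitute f u \<in> words Y" "substitute f v \<in> words Y"
    using cancel f by (auto intro: substitute_in_words)
  have "pres_eq Y R' (substitute f [(x, b), (x, \<not> b)]) []"
    using f[OF cancel(3)] by (cases b) (auto intro: pres_eq_left_inverse pres_eq_right_inverse)
  from pres_eq_append[OF this uv] show ?case by (cases b) simp_all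
next
  case (relation u v l r)
  have uv: "substitute f u \<in> words Y" "substitute f v \<in> words Y"
    using relation f by (auto intro: substitute_in_words)
  from pres_eq_append[OF rel[OF relation(3)] uv] show ?case by simp
qed

lemma pres_eq_free_imp: "pres_eq X {} v w \<Longrightarrow> pres_eq X R v w"
proof (induction rule: pres_eq.induct)
  case (cancel u v x b)
  then show ?case by (rule pres_eq.cancel)
qed (auto intro: pres_eq.intros)

section \<open>Commuting words in a presented group\<close>

definition commute :: "'a set \<Rightarrow> ('a word \<times> 'a word) set \<Rightarrow> 'a word \<Rightarrow> 'a word \<Rightarrow> bool" where
  "commute X R u v \<longleftrightarrow> pres_eq X R (u @ v) (v @ u)"

context
  fixes X :: "'a set" and R :: "('a word \<times> 'a word) set"
  assumes R: "R \<subseteq> words X \<times> words X"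
begin

lemma commute_in_words: "commute X R u v \<Longrightarrow> u \<in> words X \<and> v \<in> words X"
  unfolding commute_def by (drule pres_eq_in_words[OF _ R]) simp

lemma commute_sym: "commute X R u v \<Longrightarrow> commute X R v u"
  unfolding commute_def by (rule pres_eq.sym)

lemma commute_Nil: "u \<in> words X \<Longrightarrow> commute X R u []"
  by (simp add: commute_def pres_eq.refl)

lemma commute_append:
  assumes v: "commute X R u v" and w: "commute X R u w"
  shows "commute X R u (v @ w)"
  unfolding commute_def
proof (rule pres_eq.trans)
  show "pres_eq X R (u @ v @ w) (v @ u @ w)"
    using pres_eq_append[OF v[unfolded commute_def], of "[]" w] commute_in_words[OF w] by simp
  show "pres_eq X R (v @ u @ w) ((v @ w) @ u)"
    using pres_eq_append[OF w[unfolded commute_def], of v "[]"] commute_in_words[OF v] by simp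
qed

text \<open>The chain is u v^-1 = v^-1 v u v^-1 = v^-1 u v v^-1 = v^-1 u.\<close>

lemma commute_inverse:
  assumes uv: "commute X R u v"
  shows "commute X R u (inverse_word v)"
proof -
  have w: "u \<in> words X" "v \<in> words X" using commute_in_words[OF uv] by auto
  let ?v = "inverse_word v"
  have "pres_eq X R (u @ ?v) (?v @ v @ u @ ?v)"
    using w pres_eq_append[OF pres_eq_left_inverse[OF w(2), of R], of "[]" "u @ ?v"]
    by (auto intro: pres_eq.sym)
  moreover have "pres_eq X R (?v @ v @ u @ ?v) (?v @ u @ v @ ?v)"
    using w pres_eq_append[OF commute_sym[OF uv, unfolded commute_def], of ?v ?v] by simp
  moreover have "pres_eq X R (?v @ u @ v @ ?v) (?v @ u)"
    using w pres_eq_append[OF pres_eq_right_inverse[OF w(2), of R], of "?v @ u" "[]"] by simp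
  ultimately show ?thesis unfolding commute_def by (blast intro: pres_eq.trans)
qed

lemma commute_cong:
  assumes "commute X R u v" "pres_eq X R v v'"
  shows "commute X R u v'"
proof -
  have u: "u \<in> words X" using commute_in_words[OF assms(1)] by blast
  have "pres_eq X R (u @ v') (u @ v)" "pres_eq X R (v @ u) (v' @ u)"
    using pres_eq_append[OF assms(2), of u "[]"] pres_eq_append[OF assms(2), of "[]" u] u
    by (auto intro: pres_eq.sym)
  then show ?thesis using assms(1) unfolding commute_def by (blast intro: pres_eq.trans)
qed

text \<open>The centralizer of \<open>u\<close> is a subgroup, so it contains every product of the
  \<open>g y\<close> and their inverses.\<close>

lemma commute_substitute_right:
  assumes "u \<in> words X" "\<And>y. y \<in> B \<Longrightarrow> commute X R u (g y)" "w \<in> words B"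
  shows "commute X R u (substitute g w)"
  using assms(3)
proof (induction w)
  case Nil
  then show ?case using assms(1) by (simp add: commute_Nil)
next
  case (Cons a w)
  obtain y b where a: "a = (y, b)" by force
  have u: "commute X R u (g y)" "commute X R u (inverse_word (g y))"
    using Cons.prems a assms(2) commute_inverse by auto
  have "commute X R u (substitute g w)" using Cons by simp
  then show ?case using u commute_append by (cases b) (simp_all add: a)
qed

lemma commute_substitute:
  assumes comm: "\<And>x y. x \<in> A \<Longrightarrow> y \<in> B \<Longrightarrow> commute X R (f x) (g y)"
    and f: "\<And>x. x \<in> A \<Longrightarrow> f x \<in> words X" and g: "\<And>y. y \<in> B \<Longrightarrow> g y \<in> words X"
    and v: "v \<in> words A" and w: "w \<in> words B"
  shows "commute X R (substitute f v) (substitute g w)"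
proof (rule commute_sym, rule commute_substitute_right[OF _ _ v])
  show "substitute g w \<in> words X" using g w by (auto intro: substitute_in_words)
  show "commute X R (substitute g w) (f x)" if "x \<in> A" for x
    using commute_substitute_right[OF f[OF that] comm[OF that] w] by (rule commute_sym)
qed

lemma commute_words:
  assumes "\<And>x y. x \<in> A \<Longrightarrow> y \<in> B \<Longrightarrow> commute X R [(x, True)] [(y, True)]"
    and "A \<subseteq> X" "B \<subseteq> X" "v \<in> words A" "w \<in> words B"
  shows "commute X R v w"
  using commute_substitute[of A B "\<lambda>x. [(x, True)]" "\<lambda>x. [(x, True)]" v w] assms
  by (auto simp: substitute_generators)

lemma substitute_pointwise_cong:
  assumes "\<And>x. x \<in> A \<Longrightarrow> pres_eq X R (f x) (g x)" and "w \<in> words A"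
  shows "pres_eq X R (substitute f w) (substitute g w)"
  using assms(2)
proof (induction w)
  case Nil
  then show ?case by (simp add: pres_eq.refl)
next
  case (Cons a w)
  then show ?case
    using assms(1) by (cases a; cases "snd a") (auto intro!: pres_eq_cong[OF R] pres_eq_inverse_cong[OF R])
qed

text \<open>The pointwise product of two homomorphisms is a homomorphism when their images commute.
  This is what collects the factors of a letterwise decomposition into separate blocks.\<close>

lemma substitute_append_pointwise:
  assumes comm: "\<And>x y. x \<in> A \<Longrightarrow> y \<in> A \<Longrightarrow> commute X R (f x) (g y)"
    and w: "w \<in> words A"
  shows "pres_eq X R (substitute (\<lambda>x. f x @ g x) w) (substitute f w @ substitute g w)"
  using w
proof (induction w)
  case Nil
  then show ?case by (simp add: pres_eq.refl)
next
  case (Cons a w)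
  have fg: "f x \<in> words X" "g x \<in> words X" if "x \<in> A" for x
    using comm[OF that that] commute_in_words by auto
  let ?f = "substitute f [a]" and ?g = "substitute g [a]"
  obtain x b where a: "a = (x, b)" by force
  have x: "x \<in> A" and w: "w \<in> words A" "[a] \<in> words A" using Cons.prems a by auto
  note in_words = substitute_in_words[of _ A f X] substitute_in_words[of _ A g X]
  have "pres_eq X R (substitute (\<lambda>x. f x @ g x) [a]) (?f @ ?g)"
  proof (cases b)
    case True
    then show ?thesis using fg[OF x] by (simp add: a pres_eq.refl)
  next
    case False
    \<comment> \<open>Inverting \<open>f x @ g x\<close> reverses the two factors, so they must be
      swapped back.\<close>
    have "commute X R ?g ?f"
      using comm fg w by (intro commute_sym[OF commute_substitute]) auto
    then show ?thesis using False by (simp add: a commute_def)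
  qed
  from pres_eq_cong[OF R this Cons.IH[OF w(1)]]
  have "pres_eq X R (substitute (\<lambda>x. f x @ g x) (a # w))
      (?f @ ?g @ substitute f w @ substitute g w)"
    by (cases b) (simp_all add: a)
  \<comment> \<open>The \<open>g\<close> part of the first letter moves past the \<open>f\<close>
    part of the tail.\<close>
  moreover have "commute X R ?g (substitute f w)"
    using comm fg w by (intro commute_sym[OF commute_substitute]) auto
  then have "pres_eq X R (?f @ ?g @ substitute f w @ substitute g w)
      (?f @ substitute f w @ ?g @ substitute g w)"
    using pres_eq_append[of X R "?g @ substitute f w" "substitute f w @ ?g" ?f "substitute g w"]
      in_words[OF w(1)] in_words[OF w(2)] fg by (simp add: commute_def)
  ultimately have "pres_eq X R (substitute (\<lambda>x. f x @ g x) (a # w))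
      (?f @ substitute f w @ ?g @ substitute g w)"
    by (rule pres_eq.trans)
  then show ?case by (cases b) (simp_all add: a)
qed

end


section \<open>Free reduction\<close>

text \<open>The list is a stack with its top at the head, so it stores the word read so far in
  reverse; \<open>fold push v []\<close> is the reversed free normal form of
  \<open>v\<close>.\<close>

fun push :: "'a \<times> bool \<Rightarrow> 'a word \<Rightarrow> 'a word" where
  "push a [] = [a]"
| "push a (b # w) = (if b = apsnd Not a then w else a # b # w)"

definition reduced :: "'a word \<Rightarrow> bool" where
  "reduced = successively (\<lambda>a b. b \<noteq> apsnd Not a)"

lemma reduced_push: "reduced w \<Longrightarrow> reduced (push a w)"
  by (cases w) (auto simp: reduced_def successively_Cons)

lemma reduced_fold_push: "reduced w \<Longrightarrow> reduced (fold push v w)"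
  by (induction v arbitrary: w) (simp_all add: reduced_push)

text \<open>If \<open>a\<close> cancels the top of the stack, reducedness ensures that the next
  letter is not \<open>a\<close>, so pushing the inverse of \<open>a\<close> restores the top.
  Otherwise \<open>a\<close> lands on the stack and is removed again.\<close>

lemma push_push_inverse:
  assumes "reduced w"
  shows "push (apsnd Not a) (push a w) = w"
proof (cases w)
  case (Cons b v)
  then show ?thesis
    using assms by (cases v) (auto simp: reduced_def)
qed simp

text \<open>Van der Waerden's argument: by \<open>push_push_inverse\<close> the free group acts on
  reduced words through \<open>push\<close>. The stack stays arbitrary because a cancelling pair
  meets whatever the prefix \<open>u\<close> has left there.\<close>

lemma fold_push_pres_eq:
  assumes "pres_eq X {} v w" "reduced s"
  shows "fold push v s = fold push w s"
  using assms
proof (induction arbitrary: s rule: pres_eq.induct)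
  case (cancel u v x b)
  then show ?case
    using push_push_inverse[OF reduced_fold_push[OF cancel(4), of u], of "(x, b)"] by simp
qed auto

lemma pres_eq_push:
  assumes "fst a \<in> X" "w \<in> words X"
  shows "pres_eq X R (rev w @ [a]) (rev (push a w))"
proof (cases w)
  case (Cons b v)
  show ?thesis
  proof (cases "b = apsnd Not a")
    case True
    obtain x c where "a = (x, c)" by force
    then show ?thesis
      using assms Cons True pres_eq.cancel[of "rev v" X "[]" x R "\<not> c"] by simp
  qed (use assms Cons in \<open>auto intro: pres_eq.refl\<close>)
qed (use assms in \<open>auto intro: pres_eq.refl\<close>)

lemma push_in_words: "fst a \<in> X \<Longrightarrow> w \<in> words X \<Longrightarrow> push a w \<in> words X"
  by (cases w) auto

text \<open>Invariant of the stack machine: the reversed stack followed by the unread input always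
  represents the same element.\<close>

lemma pres_eq_fold_push:
  "v \<in> words X \<Longrightarrow> w \<in> words X \<Longrightarrow> pres_eq X R (rev w @ v) (rev (fold push v w))"
proof (induction v arbitrary: w)
  case Nil
  then show ?case by (simp add: pres_eq.refl)
next
  case (Cons a v)
  have "pres_eq X R (rev w @ [a] @ v) (rev (push a w) @ v)"
    using pres_eq_append[OF pres_eq_push[of a X w R], of "[]" v] Cons.prems by simp
  moreover have "pres_eq X R (rev (push a w) @ v) (rev (fold push v (push a w)))"
    using Cons.prems by (intro Cons.IH push_in_words) simp_all
  ultimately show ?case using pres_eq.trans by fastforce
qed

lemma free_pres_eq_iff:
  assumes "v \<in> words X" "w \<in> words X"
  shows "pres_eq X {} v w \<longleftrightarrow> fold push v [] = fold push w []"
proof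
  show "fold push v [] = fold push w []" if "pres_eq X {} v w"
    using fold_push_pres_eq[OF that] by (simp add: reduced_def)
  have nf: "pres_eq X {} u (rev (fold push u []))" if "u \<in> words X" for u
    using pres_eq_fold_push[OF that, of "[]"] by simp
  show "pres_eq X {} v w" if "fold push v [] = fold push w []"
    using nf[OF assms(1)] pres_eq.sym[OF nf[OF assms(2)]] unfolding that by (rule pres_eq.trans)
qed


section \<open>Recursive functions\<close>

text \<open>\<^const>\<open>total_recursive\<close> constrains a function also at argument lists of the wrong length;
  the following closure of it does not.\<close>

definition recursive :: "nat \<Rightarrow> (nat list \<Rightarrow> nat) \<Rightarrow> bool" where
  "recursive k f \<longleftrightarrow> (\<exists>g. total_recursive k g \<and> (\<forall>xs. length xs = k \<longrightarrow> g xs = f xs))"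

lemma recursive_cong:
  "recursive k f \<Longrightarrow> (\<And>xs. length xs = k \<Longrightarrow> f xs = g xs) \<Longrightarrow> recursive k g"
  unfolding recursive_def by metis

lemma recursive_nth: "i < k \<Longrightarrow> recursive k (\<lambda>xs. xs ! i)"
  unfolding recursive_def using total_recursive.proj by blast

lemma recursive_comp:
  assumes "recursive (length hs) g" "\<And>h. h \<in> set hs \<Longrightarrow> recursive k h"
  shows "recursive k (\<lambda>xs. g (map (\<lambda>h. h xs) hs))"
proof -
  obtain g' where g': "total_recursive (length hs) g'" "\<And>xs. length xs = length hs \<Longrightarrow> g' xs = g xs"
    using assms(1) by (auto simp: recursive_def)
  obtain t where t: "\<And>h. h \<in> set hs \<Longrightarrow> total_recursive k (t h)"
      "\<And>h xs. h \<in> set hs \<Longrightarrow> length xs = k \<Longrightarrow> t h xs = h xs"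
    using assms(2) unfolding recursive_def by metis
  have "total_recursive k (\<lambda>xs. g' (map (\<lambda>h. h xs) (map t hs)))"
    using g'(1) t(1) by (intro total_recursive.comp) auto
  moreover have "g' (map (\<lambda>h. h xs) (map t hs)) = g (map (\<lambda>h. h xs) hs)" if "length xs = k" for xs
    using t(2) that by (simp add: g'(2) comp_def cong: map_cong)
  ultimately show ?thesis unfolding recursive_def by blast
qed

lemma recursive_comp1: "recursive 1 (\<lambda>xs. F (xs ! 0)) \<Longrightarrow> recursive k f \<Longrightarrow> recursive k (\<lambda>xs. F (f xs))"
  using recursive_comp[of "[f]" "\<lambda>xs. F (xs ! 0)" k] by simp

lemma recursive_comp2:
  "recursive 2 (\<lambda>xs. F (xs ! 0) (xs ! 1)) \<Longrightarrow> recursive k f \<Longrightarrow> recursive k g \<Longrightarrow>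
    recursive k (\<lambda>xs. F (f xs) (g xs))"
  using recursive_comp[of "[f, g]" "\<lambda>xs. F (xs ! 0) (xs ! 1)" k] by (auto simp: numeral_2_eq_2)

lemma recursive_comp3:
  "recursive 3 (\<lambda>xs. F (xs ! 0) (xs ! 1) (xs ! 2)) \<Longrightarrow>
    recursive k f \<Longrightarrow> recursive k g \<Longrightarrow> recursive k h \<Longrightarrow> recursive k (\<lambda>xs. F (f xs) (g xs) (h xs))"
  using recursive_comp[of "[f, g, h]" "\<lambda>xs. F (xs ! 0) (xs ! 1) (xs ! 2)" k]
  by (auto simp: numeral_2_eq_2 numeral_3_eq_3)

lemma recursive_prim_rec:
  assumes "recursive k g" "recursive (Suc (Suc k)) h"
  shows "recursive (Suc k) (\<lambda>xs. rec_nat (g (tl xs)) (\<lambda>y r. h (y # r # tl xs)) (hd xs))"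
proof -
  obtain g' where g': "total_recursive k g'" "\<And>xs. length xs = k \<Longrightarrow> g' xs = g xs"
    using assms(1) by (auto simp: recursive_def)
  obtain h' where h': "total_recursive (Suc (Suc k)) h'"
      "\<And>xs. length xs = Suc (Suc k) \<Longrightarrow> h' xs = h xs"
    using assms(2) by (auto simp: recursive_def)
  show ?thesis
    unfolding recursive_def
    using total_recursive.prim_rec[OF g'(1) h'(1)] by (intro exI conjI) (auto simp: g'(2) h'(2))
qed

lemma recursive_minim:
  assumes "recursive (Suc k) g" "\<And>xs. length xs = k \<Longrightarrow> \<exists>y. g (y # xs) = 0"
  shows "recursive k (\<lambda>xs. LEAST y. g (y # xs) = 0)"
proof -
  obtain g' where g': "total_recursive (Suc k) g'" "\<And>xs. length xs = Suc k \<Longrightarrow> g' xs = g xs"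
    using assms(1) by (auto simp: recursive_def)
  show ?thesis
    unfolding recursive_def
    using total_recursive.minim[OF g'(1)] assms(2) by (intro exI conjI) (auto simp: g'(2))
qed

lemma recursive_Suc: "recursive k f \<Longrightarrow> recursive k (\<lambda>xs. Suc (f xs))"
  by (rule recursive_comp1[of Suc]) (use total_recursive.succ in \<open>auto simp: recursive_def\<close>)

lemma recursive_const: "recursive k (\<lambda>xs. a)"
proof (induction a)
  case 0
  show ?case unfolding recursive_def using total_recursive.zero by blast
qed (rule recursive_Suc)

lemma recursive_rec1:
  assumes "recursive 2 (\<lambda>xs. h (xs ! 0) (xs ! 1))" "recursive k f"
  shows "recursive k (\<lambda>xs. rec_nat a h (f xs))"
proof (rule recursive_comp1[OF _ assms(2)])
  from recursive_prim_rec[OF recursive_const[of 0 a], of "\<lambda>xs. h (xs ! 0) (xs ! 1)"]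
  have "recursive 1 (\<lambda>xs. rec_nat a h (hd xs))" using assms(1) by (simp add: numeral_2_eq_2)
  then show "recursive 1 (\<lambda>xs. rec_nat a h (xs ! 0))"
    by (rule recursive_cong) (auto simp: length_Suc_conv)
qed

lemma recursive_rec2:
  assumes "recursive 1 (\<lambda>xs. b (xs ! 0))" "recursive 3 (\<lambda>xs. h (xs ! 0) (xs ! 1) (xs ! 2))"
    and "recursive k f" "recursive k g"
  shows "recursive k (\<lambda>xs. rec_nat (b (g xs)) (\<lambda>y r. h y r (g xs)) (f xs))"
proof (rule recursive_comp2[OF _ assms(3,4)])
  have "recursive 2 (\<lambda>xs. rec_nat (b (tl xs ! 0)) (\<lambda>y r. h y r (tl xs ! 0)) (hd xs))"
    using recursive_prim_rec[OF assms(1), of "\<lambda>xs. h (xs ! 0) (xs ! 1) (xs ! 2)"] assms(2)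
    by (simp add: numeral_2_eq_2 numeral_3_eq_3)
  then show "recursive 2 (\<lambda>xs. rec_nat (b (xs ! 1)) (\<lambda>y r. h y r (xs ! 1)) (xs ! 0))"
    by (rule recursive_cong) (auto simp: length_Suc_conv numeral_2_eq_2)
qed

section \<open>Arithmetic and case distinction\<close>

lemma recursive_add:
  assumes "recursive k f" "recursive k g"
  shows "recursive k (\<lambda>xs. f xs + g xs)"
proof -
  have "rec_nat b (\<lambda>y r. Suc r) a = a + b" for a b by (induction a) auto
  then show ?thesis
    using recursive_rec2[of "\<lambda>x. x" "\<lambda>y r x. Suc r", OF _ _ assms]
    by (simp add: recursive_nth recursive_Suc)
qed

lemma recursive_pred:
  assumes "recursive k f"
  shows "recursive k (\<lambda>xs. f xs - 1)"
proof -
  have "rec_nat 0 (\<lambda>y r. y) a = a - 1" for a by (cases a) auto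
  then show ?thesis
    using recursive_rec1[of "\<lambda>y r. y" k f 0] assms by (simp add: recursive_nth)
qed

lemma recursive_diff:
  assumes "recursive k f" "recursive k g"
  shows "recursive k (\<lambda>xs. f xs - g xs)"
proof -
  \<comment> \<open>The recursion runs over the subtrahend, hence the swapped order
    \<open>assms(2,1)\<close> below.\<close>
  have "rec_nat a (\<lambda>y r. r - 1) b = a - b" for a b by (induction b) auto
  then show ?thesis
    using recursive_rec2[of "\<lambda>x. x" "\<lambda>y r x. r - 1", OF _ _ assms(2,1)] recursive_pred
    by (simp add: recursive_nth)
qed

lemma recursive_if_eq:
  assumes f: "recursive k f" and g: "recursive k g" and a: "recursive k a" and b: "recursive k b"
  shows "recursive k (\<lambda>xs. if f xs = g xs then a xs else b xs)"
proof -
  \<comment> \<open>Recursion with a constant step is a test for zero: it yields \<open>a\<close> at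
    zero and \<open>b\<close> elsewhere. With truncated subtraction, (x - y) + (y - x) vanishes iff
    x = y.\<close>
  let ?if = "\<lambda>x a b. rec_nat a (\<lambda>y r. b) x :: nat"
  \<comment> \<open>For arguments x, a, b the step function sees the list y, r, a, b, so index 3
    selects b.\<close>
  have "recursive 3 (\<lambda>xs. rec_nat (tl xs ! 0) (\<lambda>y r. (y # r # tl xs) ! 3) (hd xs))"
    using recursive_prim_rec[of 2 "\<lambda>xs. xs ! 0" "\<lambda>xs. xs ! 3"]
    by (simp add: recursive_nth numeral_3_eq_3 numeral_2_eq_2)
  then have "recursive 3 (\<lambda>xs. ?if (xs ! 0) (xs ! 1) (xs ! 2))"
    by (rule recursive_cong) (auto simp: length_Suc_conv numeral_3_eq_3 numeral_2_eq_2)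
  then have "recursive k (\<lambda>xs. ?if ((f xs - g xs) + (g xs - f xs)) (a xs) (b xs))"
    by (rule recursive_comp3[of ?if]) (intro recursive_add recursive_diff f g a b)+
  moreover have "?if ((x - y) + (y - x)) c d = (if x = y then c else d)" for x y c d :: nat
    by (cases "(x - y) + (y - x)") auto
  ultimately show ?thesis by (simp cong: if_cong)
qed

section \<open>Cantor pairing and its inverse\<close>

lemma recursive_triangle: "recursive k f \<Longrightarrow> recursive k (\<lambda>xs. triangle (f xs))"
proof -
  assume f: "recursive k f"
  have "rec_nat 0 (\<lambda>y r. r + Suc y) a = triangle a" for a by (induction a) auto
  then show ?thesis
    using recursive_rec1[of "\<lambda>y r. r + Suc y", OF _ f, of 0]
    by (simp add: recursive_nth recursive_add recursive_Suc)
qed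

lemma recursive_prod_encode:
  "recursive k f \<Longrightarrow> recursive k g \<Longrightarrow> recursive k (\<lambda>xs. prod_encode (f xs, g xs))"
  by (simp add: prod_encode_def recursive_add recursive_triangle)

lemma triangle_mono: "a \<le> b \<Longrightarrow> triangle a \<le> triangle b"
  unfolding triangle_def by (intro div_le_mono mult_le_mono) auto

text \<open>The code of (a, b) is \<open>triangle (a + b) + a\<close>, which lies in the half-open
  interval from \<open>triangle (a + b)\<close> to \<open>triangle (Suc (a + b))\<close>. The
  vanishing truncated difference says that the code is below
  \<open>triangle (Suc k)\<close>.\<close>

lemma Least_triangle: "(LEAST k. Suc (prod_encode (a, b)) - triangle (Suc k) = 0) = a + b"
proof (rule Least_equality)
  show "Suc (prod_encode (a, b)) - triangle (Suc (a + b)) = 0"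
    by (simp add: prod_encode_def)
  fix k
  assume k: "Suc (prod_encode (a, b)) - triangle (Suc k) = 0"
  show "a + b \<le> k"
  proof (rule ccontr)
    assume "\<not> a + b \<le> k"
    then have "triangle (Suc k) \<le> triangle (a + b)" by (intro triangle_mono) simp
    then show False using k by (simp add: prod_encode_def)
  qed
qed

text \<open>Minimization recovers the sum \<open>s\<close> of the two components. The first
  component is then the distance of the code from \<open>triangle s\<close>, and the second is the
  rest of \<open>s\<close>.\<close>

lemma
  assumes "recursive k f"
  shows recursive_fst_prod_decode: "recursive k (\<lambda>xs. fst (prod_decode (f xs)))"
    and recursive_snd_prod_decode: "recursive k (\<lambda>xs. snd (prod_decode (f xs)))"
proof -
  define s where "s n = (LEAST k. Suc n - triangle (Suc k) = 0)" for n
  have s: "s n = fst (prod_decode n) + snd (prod_decode n)" for n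
    using Least_triangle[of "fst (prod_decode n)" "snd (prod_decode n)"] by (simp add: s_def)
  have n: "n = triangle (s n) + fst (prod_decode n)" for n
    using prod_decode_inverse[of n] unfolding s by (cases "prod_decode n") (simp add: prod_encode_def)
  have "recursive 1 (\<lambda>xs. LEAST k. Suc ((k # xs) ! 1) - triangle (Suc ((k # xs) ! 0)) = 0)"
  proof (rule recursive_minim)
    show "recursive (Suc 1) (\<lambda>xs. Suc (xs ! 1) - triangle (Suc (xs ! 0)))"
      by (intro recursive_diff recursive_triangle recursive_Suc recursive_nth) auto
    show "\<exists>y. Suc ((y # xs) ! 1) - triangle (Suc ((y # xs) ! 0)) = 0" for xs
      \<comment> \<open>The search stops at the latest at the code itself, since
        \<open>triangle (Suc n)\<close> is \<open>triangle n + Suc n\<close>.\<close>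
      by (rule exI[of _ "xs ! 0"]) simp
  qed
  then have "recursive 1 (\<lambda>xs. s (xs ! 0))"
    by (simp add: s_def)
  from recursive_comp1[OF this assms] have rec_s: "recursive k (\<lambda>xs. s (f xs))" .
  have fst: "fst (prod_decode a) = a - triangle (s a)" for a
    using n[of a] by simp
  show rec_fst: "recursive k (\<lambda>xs. fst (prod_decode (f xs)))"
    unfolding fst by (intro recursive_diff recursive_triangle rec_s assms)
  have snd: "snd (prod_decode a) = s a - fst (prod_decode a)" for a
    using s[of a] by simp
  show "recursive k (\<lambda>xs. snd (prod_decode (f xs)))"
    unfolding snd by (intro recursive_diff rec_s rec_fst)
qed

lemma recursive_funpow:
  assumes "recursive 1 (\<lambda>xs. F (xs ! 0))" "recursive k f" "recursive k g"
  shows "recursive k (\<lambda>xs. (F ^^ f xs) (g xs))"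
proof -
  have "rec_nat a (\<lambda>y r. F r) b = (F ^^ b) a" for a b by (induction b) auto
  then show ?thesis
    using recursive_rec2[of "\<lambda>x. x" "\<lambda>y r x. F r", OF _ _ assms(2,3)] recursive_comp1[OF assms(1)]
    by (simp add: recursive_nth)
qed


section \<open>Deciding free equality of substituted words\<close>

definition letter_code :: "('a \<Rightarrow> nat) \<Rightarrow> 'a \<times> bool \<Rightarrow> nat" where
  "letter_code num a = 2 * num (fst a) + (if snd a then 0 else 1)"

text \<open>A nonempty word has the successor of a pair as its code, so predecessor and unpairing
  read off the first letter and the tail.\<close>

lemma word_code_simps [simp]:
  "word_code num [] = 0"
  "word_code num (a # w) = Suc (prod_encode (letter_code num a, word_code num w))"
  by (cases a; simp add: word_code_def letter_code_def)+

lemma letter_code_eq_iff: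
  assumes "inj num"
  shows "letter_code num a = letter_code num b \<longleftrightarrow> a = b"
proof
  assume "letter_code num a = letter_code num b"
  then have "word_code num [a] = word_code num [b]" by simp
  then show "a = b" using injD[OF inj_word_code[OF assms]] by fastforce
qed simp

text \<open>Lets the code of a word serve as a computable bound on the number of letters to
  process.\<close>

lemma length_le_word_code: "length w \<le> word_code num w"
proof (induction w)
  case (Cons a w)
  then show ?case using le_prod_encode_2[of "word_code num w" "letter_code num a"] by simp
qed simp

lemma recursive_push:
  assumes "inj num"
  shows "\<exists>f. recursive 1 (\<lambda>xs. f (xs ! 0)) \<and> (\<forall>w. f (word_code num w) = word_code num (push a w))"
proof -
  let ?hd = "\<lambda>x. fst (prod_decode (x - 1))" and ?tl = "\<lambda>x. snd (prod_decode (x - 1))"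
  let ?cons = "\<lambda>x. Suc (prod_encode (letter_code num a, x))"
  define f where "f x = (if x = 0 then ?cons x
    else if ?hd x = letter_code num (apsnd Not a) then ?tl x else ?cons x)" for x
  have "f (word_code num w) = word_code num (push a w)" for w
    by (cases w) (simp_all add: f_def letter_code_eq_iff[OF assms])
  moreover have "recursive 1 (\<lambda>xs. f (xs ! 0))"
    unfolding f_def
    by (intro recursive_if_eq recursive_fst_prod_decode recursive_snd_prod_decode recursive_pred
      recursive_const recursive_Suc recursive_prod_encode recursive_nth) simp_all
  ultimately show ?thesis by blast
qed

text \<open>Here \<open>v\<close> is fixed, so the function is a finite composition of pushes of
  fixed letters.\<close>

lemma recursive_fold_push:
  assumes "inj num"
  shows "\<exists>f. recursive 1 (\<lambda>xs. f (xs ! 0)) \<and>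
    (\<forall>w. f (word_code num w) = word_code num (fold push v w))"
proof (induction v)
  case Nil
  show ?case by (rule exI[of _ "\<lambda>x. x"]) (simp add: recursive_nth)
next
  case (Cons a v)
  obtain f where f: "recursive 1 (\<lambda>xs. f (xs ! 0))"
      "\<And>w. f (word_code num w) = word_code num (fold push v w)"
    using Cons by blast
  obtain g where g: "recursive 1 (\<lambda>xs. g (xs ! 0))"
      "\<And>w. g (word_code num w) = word_code num (push a w)"
    using recursive_push[OF assms] by blast
  show ?case
    using recursive_comp1[OF f(1) g(1)] by (intro exI[of _ "\<lambda>x. f (g x)"]) (simp add: f(2) g(2))
qed

text \<open>With finitely many letters, the dependence on the letter is a nested case distinction on
  its code.\<close>

lemma recursive_fold_push_table:
  assumes "inj num"
  shows "\<exists>f. recursive 2 (\<lambda>xs. f (xs ! 0) (xs ! 1)) \<and>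
    (\<forall>a\<in>set as. \<forall>w. f (letter_code num a) (word_code num w) = word_code num (fold push (h a) w))"
proof (induction as)
  case Nil
  \<comment> \<open>The empty table imposes no condition, so the default value is arbitrary.\<close>
  show ?case by (rule exI[of _ "\<lambda>x y. x"]) (simp add: recursive_nth)
next
  case (Cons b as)
  obtain f where f: "recursive 2 (\<lambda>xs. f (xs ! 0) (xs ! 1))"
      "\<And>a w. a \<in> set as \<Longrightarrow>
        f (letter_code num a) (word_code num w) = word_code num (fold push (h a) w)"
    using Cons by blast
  obtain g where g: "recursive 1 (\<lambda>xs. g (xs ! 0))"
      "\<And>w. g (word_code num w) = word_code num (fold push (h b) w)"
    using recursive_fold_push[OF assms] by blast
  let ?f = "\<lambda>x y. if x = letter_code num b then g y else f x y"
  have "recursive 2 (\<lambda>xs. ?f (xs ! 0) (xs ! 1))"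
    by (rule recursive_if_eq[OF _ _ recursive_comp1[OF g(1)] f(1)])
      (simp_all add: recursive_nth recursive_const)
  moreover have "?f (letter_code num a) (word_code num w) = word_code num (fold push (h a) w)"
    if "a \<in> set (b # as)" for a w
    using that f(2)[of a w] g(2) by (cases "a = b") (simp_all add: letter_code_eq_iff[OF assms])
  ultimately show ?case by (intro exI[of _ ?f]) blast
qed

text \<open>A machine reads the input letter by letter and pushes the image of each letter under
  \<open>h\<close>; iterating its step function carries out substitution and free reduction
  together.\<close>

lemma recursive_free_reduction:
  assumes num: "inj num" and X: "finite X"
  shows "\<exists>f. recursive 1 (\<lambda>xs. f (xs ! 0)) \<and>
    (\<forall>w\<in>words X. f (word_code num w) = word_code num (fold push (substitute h w) []))"
proof -
  obtain as where as: "set as = X \<times> (UNIV :: bool set)"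
    using X finite_list[of "X \<times> (UNIV :: bool set)"] by auto
  obtain f where f: "recursive 2 (\<lambda>xs. f (xs ! 0) (xs ! 1))"
      "\<And>a w. a \<in> set as \<Longrightarrow>
        f (letter_code num a) (word_code num w) = word_code num (fold push (substitute h [a]) w)"
    using recursive_fold_push_table[OF num, of as "\<lambda>a. substitute h [a]"] by blast
  let ?word = "\<lambda>p. fst (prod_decode p)" and ?stack = "\<lambda>p. snd (prod_decode p)"
  \<comment> \<open>A state pairs the code of the unread input with the code of the stack. A state
    with empty input, coded by 0, is a fixed point, so surplus iterations are harmless.\<close>
  define step where "step p = (if ?word p = 0 then p
    else prod_encode (snd (prod_decode (?word p - 1)),
      f (fst (prod_decode (?word p - 1))) (?stack p)))" for p
  have rec_step: "recursive 1 (\<lambda>xs. step (xs ! 0))"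
    unfolding step_def
    by (intro recursive_if_eq recursive_fst_prod_decode recursive_snd_prod_decode recursive_pred
      recursive_const recursive_prod_encode recursive_nth recursive_comp2[OF f(1)]) simp_all
  have run: "(step ^^ k) (prod_encode (word_code num w, word_code num s)) =
      prod_encode (0, word_code num (fold push (substitute h w) s))"
    if "length w \<le> k" "w \<in> words X" for k w s
    using that
  proof (induction k arbitrary: w s)
    case 0
    then show ?case by simp
  next
    case (Suc k)
    show ?case
    proof (cases w)
      case Nil
      then show ?thesis using Suc.IH[of "[]"] by (simp add: funpow_Suc_right step_def del: funpow.simps)
    next
      case (Cons a v)
      then have "a \<in> set as" using Suc.prems as by (cases a) auto
      then have "step (prod_encode (word_code num w, word_code num s)) =
          prod_encode (word_code num v, word_code num (fold push (substitute h [a]) s))"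
        by (simp add: step_def Cons f(2))
      moreover have "substitute h w = substitute h [a] @ substitute h v"
        by (simp add: Cons substitute_def)
      ultimately show ?thesis
        using Suc.IH[of v] Suc.prems Cons by (simp add: funpow_Suc_right del: funpow.simps)
    qed
  qed
  \<comment> \<open>The input code \<open>x\<close> is also the number of iterations, which suffices
    by \<open>length_le_word_code\<close>; the 0 is the empty stack.\<close>
  let ?f = "\<lambda>x. ?stack ((step ^^ x) (prod_encode (x, 0)))"
  have "?f (word_code num w) = word_code num (fold push (substitute h w) [])" if "w \<in> words X" for w
    using run[OF length_le_word_code[of w num] that, of "[]"] by simp
  moreover have "recursive 1 (\<lambda>xs. ?f (xs ! 0))"
    by (intro recursive_snd_prod_decode recursive_funpow[OF rec_step] recursive_prod_encode
      recursive_nth recursive_const) simp_all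
  ultimately show ?thesis by (intro exI[of _ ?f]) blast
qed

text \<open>Free equality is equality of normal forms, and by injectivity of
  \<open>word_code\<close> it can be tested on their codes; the tests for the members of
  \<open>hs\<close> are nested.\<close>

lemma recursive_free_equality:
  assumes num: "inj num" and X: "finite X" and h: "\<And>h x. h \<in> set hs \<Longrightarrow> x \<in> X \<Longrightarrow> h x \<in> words X"
  shows "\<exists>f. recursive 2 f \<and> (\<forall>v\<in>words X. \<forall>w\<in>words X. f [word_code num v, word_code num w] =
    (if \<forall>h\<in>set hs. pres_eq X {} (substitute h v) (substitute h w) then 1 else 0))"
  using h
proof (induction hs)
  case Nil
  show ?case by (rule exI[of _ "\<lambda>xs. 1"]) (simp add: recursive_const)
next
  case (Cons h hs)
  from Cons obtain f where f: "recursive 2 f" "\<And>v w. v \<in> words X \<Longrightarrow> w \<in> words X \<Longrightarrow>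
      f [word_code num v, word_code num w] =
        (if \<forall>h\<in>set hs. pres_eq X {} (substitute h v) (substitute h w) then 1 else 0)"
    by (metis list.set_intros(2))
  obtain g where g: "recursive 1 (\<lambda>xs. g (xs ! 0))"
      "\<And>w. w \<in> words X \<Longrightarrow> g (word_code num w) = word_code num (fold push (substitute h w) [])"
    using recursive_free_reduction[OF num X, of h] by blast
  let ?f = "\<lambda>xs. if g (xs ! 0) = g (xs ! 1) then f xs else 0"
  have "recursive 2 ?f"
    by (intro recursive_if_eq recursive_comp1[OF g(1)] f(1) recursive_nth recursive_const) simp_all
  moreover have "?f [word_code num v, word_code num w] =
      (if \<forall>h\<in>set (h # hs). pres_eq X {} (substitute h v) (substitute h w) then 1 else 0)"
    if "v \<in> words X" "w \<in> words X" for v w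
  proof -
    have "substitute h v \<in> words X" "substitute h w \<in> words X"
      using that Cons.prems by (auto intro: substitute_in_words)
    then have "g (word_code num v) = g (word_code num w) \<longleftrightarrow>
        pres_eq X {} (substitute h v) (substitute h w)"
      using injD[OF inj_word_code[OF num]] by (auto simp: g(2) that free_pres_eq_iff)
    then show ?thesis using f(2)[OF that] by simp
  qed
  ultimately show ?case by blast
qed

text \<open>The hypothesis \<open>iff\<close> says that the members of \<open>hs\<close> induce an
  embedding of the presented group into a product of finitely many free groups, where equality is
  decidable.\<close>

theorem word_problem_solvable_if_free_equality:
  assumes "inj num" "finite X" "\<And>h x. h \<in> set hs \<Longrightarrow> x \<in> X \<Longrightarrow> h x \<in> words X"
    and iff: "\<And>v w. v \<in> words X \<Longrightarrow> w \<in> words X \<Longrightarrow>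
      pres_eq X R v w \<longleftrightarrow> (\<forall>h\<in>set hs. pres_eq X {} (substitute h v) (substitute h w))"
  shows "word_problem_solvable num X R"
proof -
  obtain f where f: "recursive 2 f" "\<And>v w. v \<in> words X \<Longrightarrow> w \<in> words X \<Longrightarrow>
      f [word_code num v, word_code num w] =
        (if \<forall>h\<in>set hs. pres_eq X {} (substitute h v) (substitute h w) then 1 else 0)"
    using recursive_free_equality[OF assms(1,2), of hs] assms(3) by blast
  obtain g where g: "total_recursive 2 g" "\<And>xs. length xs = 2 \<Longrightarrow> g xs = f xs"
    using f(1) by (auto simp: recursive_def)
  show ?thesis
    unfolding word_problem_solvable_def
    using g f(2) by (intro exI[of _ g]) (simp add: element_eq_iff iff)
qed


section \<open>Splitting \<open>G\<^sub>m\<^sub>,\<^sub>n\<close> into a product of free groups\<close>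

abbreviation positive :: "'a list \<Rightarrow> 'a word" where
  "positive \<equiv> map (\<lambda>x. (x, True))"

section \<open>Cyclic relations and their images under substitution\<close>

lemma cyclic_relation_split:
  assumes "a @ b \<noteq> []"
  shows "(positive (a @ b), positive (b @ a)) \<in> cyclic_relations (a @ b)"
proof (cases "b = []")
  case True
  \<comment> \<open>The index \<open>length a\<close> is out of range here; rotation by 0 serves for
    both sides.\<close>
  then show ?thesis using assms unfolding cyclic_relations_def by (auto intro!: exI[of _ 0])
next
  case False
  then show ?thesis using assms unfolding cyclic_relations_def
    by (intro CollectI exI[of _ 0] exI[of _ "length a"]) (simp add: rotate_append)
qed

lemma pres_eq_cyclic:
  assumes "cyclic_relations (a @ b) \<subseteq> R" "set (a @ b) \<subseteq> X"
  shows "pres_eq X R (positive (a @ b)) (positive (b @ a))"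
proof (cases "a @ b = []")
  case False
  then show ?thesis
    using pres_eq.relation[of "[]" X "[]" "positive (a @ b)" "positive (b @ a)" R]
      cyclic_relation_split[OF False] assms(1) by auto
qed (simp add: pres_eq.refl)

text \<open>Writing the product as a x b, the words b a x and x b a are both rotations of it, and x
  (b a x) = (x b a) x.\<close>

lemma commute_cyclic_product:
  assumes R: "R \<subseteq> words X \<times> words X" and cyc: "cyclic_relations xs \<subseteq> R"
    and xs: "set xs \<subseteq> X" and x: "x \<in> set xs"
  shows "commute X R [(x, True)] (positive xs)"
proof -
  obtain a b where ab: "xs = a @ x # b" using x by (auto dest: split_list)
  have 1: "pres_eq X R (positive xs) (positive (x # b @ a))"
    using pres_eq_cyclic[of a "x # b" R X] cyc xs by (simp add: ab)
  have 2: "pres_eq X R (positive xs) (positive (b @ a @ [x]))"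
    using pres_eq_cyclic[of "a @ [x]" b R X] cyc xs by (simp add: ab)
  have "x \<in> X" using x xs by blast
  then have "pres_eq X R ([(x, True)] @ positive xs) (positive (x # b @ a @ [x]))"
      "pres_eq X R (positive (x # b @ a @ [x])) (positive xs @ [(x, True)])"
    using pres_eq_append[OF 2, of "[(x, True)]" "[]"]
      pres_eq_append[OF pres_eq.sym[OF 1], of "[]" "[(x, True)]"] by auto
  then show ?thesis unfolding commute_def by (rule pres_eq.trans)
qed

text \<open>If the head has a nonempty image, all other images are empty, so its position does not
  matter.\<close>

lemma concat_map_rotate1:
  assumes "length (filter (\<lambda>x. f x \<noteq> []) xs) \<le> 1"
  shows "concat (map f (rotate1 xs)) = concat (map f xs)"
proof (cases xs)
  case (Cons x ys)
  show ?thesis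
  proof (cases "f x = []")
    case False
    then have "concat (map f ys) = []" using assms Cons by (auto simp: filter_empty_conv)
    then show ?thesis using Cons by (simp del: concat_eq_Nil_conv)
  qed (simp add: Cons)
qed simp

lemma length_filter_rotate: "length (filter P (rotate i xs)) = length (filter P xs)"
proof (induction i)
  case (Suc i)
  have "length (filter P (rotate1 ys)) = length (filter P ys)" for ys by (cases ys) auto
  then show ?case using Suc by simp
qed simp

lemma concat_map_rotate:
  "length (filter (\<lambda>x. f x \<noteq> []) xs) \<le> 1 \<Longrightarrow> concat (map f (rotate i xs)) = concat (map f xs)"
proof (induction i)
  case (Suc i)
  then show ?case using concat_map_rotate1[of f "rotate i xs"] by (simp add: length_filter_rotate)
qed simp

text \<open>When at most one letter survives, all rotations have literally the same image. This
  covers every relation that a projection does not send to a trivial product.\<close>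

lemma pres_eq_substitute_cyclic_single:
  assumes "length (filter (\<lambda>x. f x \<noteq> []) xs) \<le> 1" "\<And>x. x \<in> set xs \<Longrightarrow> f x \<in> words Y"
    and "(l, r) \<in> cyclic_relations xs"
  shows "pres_eq Y R (substitute f l) (substitute f r)"
proof -
  have "concat (map f xs) \<in> words Y" using assms(2) by (induction xs) auto
  then show ?thesis
    using assms(3) concat_map_rotate[OF assms(1)]
    by (auto simp: cyclic_relations_def substitute_positive intro: pres_eq.refl)
qed

text \<open>Rotations of a product are conjugate, so if one of them becomes trivial, all do.\<close>

lemma pres_eq_substitute_cyclic_trivial:
  assumes R: "R \<subseteq> words Y \<times> words Y" and triv: "pres_eq Y R (concat (map f xs)) []"
    and lr: "(l, r) \<in> cyclic_relations xs"
  shows "pres_eq Y R (substitute f l) (substitute f r)"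
proof -
  have rot: "pres_eq Y R (concat (map f (rotate i xs))) []" for i
  proof -
    \<comment> \<open>Rotation by \<open>i\<close> swaps the two blocks into which position
      \<open>?i\<close> cuts the list.\<close>
    let ?i = "i mod length xs"
    have "concat (map f xs) = concat (map f (take ?i xs)) @ concat (map f (drop ?i xs))"
      by (metis append_take_drop_id concat_append map_append)
    then show ?thesis
      using pres_eq_rotate_Nil[OF R] triv by (simp add: rotate_drop_take)
  qed
  then show ?thesis
    using lr by (auto simp: cyclic_relations_def substitute_positive
      intro: pres_eq.trans[OF rot pres_eq.sym[OF rot]])
qed

section \<open>The three projections to free groups\<close>

definition Ts :: "nat \<Rightarrow> gen list" where
  "Ts m = map T [1..<Suc m]"

definition Us :: "nat \<Rightarrow> gen list" where
  "Us n = map U [1..<Suc n]"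

text \<open>The value at \<open>S\<close> is the T-component of s = P^-1 Q^-1 z;
  \<open>proj_U\<close> takes the U-component.\<close>

fun proj_T :: "nat \<Rightarrow> gen \<Rightarrow> gen word" where
  "proj_T m S = inverse_word (positive (Ts m))"
| "proj_T m (T i) = [(T i, True)]"
| "proj_T m (U j) = []"

fun proj_U :: "nat \<Rightarrow> gen \<Rightarrow> gen word" where
  "proj_U n S = inverse_word (positive (Us n))"
| "proj_U n (T i) = []"
| "proj_U n (U j) = [(U j, True)]"

text \<open>The central generator \<open>z\<close> is represented by the letter \<open>S\<close>.\<close>

fun proj_Z :: "gen \<Rightarrow> gen word" where
  "proj_Z S = [(S, True)]"
| "proj_Z (T i) = []"
| "proj_Z (U j) = []"

definition central :: "nat \<Rightarrow> nat \<Rightarrow> gen word" where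
  "central m n = positive (S # Ts m) @ positive (Us n)"

lemma set_Ts: "set (Ts m) = T ` {1..m}" and set_Us: "set (Us n) = U ` {1..n}"
  by (auto simp: Ts_def Us_def)

lemma G_gens_sets: "G_gens m n = {S} \<union> set (Ts m) \<union> set (Us n)"
  by (simp add: G_gens_def set_Ts set_Us)

lemma in_G_gens [simp]:
  "S \<in> G_gens m n" "set (Ts m) \<subseteq> G_gens m n" "set (Us n) \<subseteq> G_gens m n"
  by (auto simp: G_gens_sets)

lemma G_rels_cyclic:
  "cyclic_relations (S # Ts m) \<subseteq> G_rels m n"
  "cyclic_relations (S # Us n) \<subseteq> G_rels m n"
  "t \<in> set (Ts m) \<Longrightarrow> u \<in> set (Us n) \<Longrightarrow> cyclic_relations [t, u] \<subseteq> G_rels m n"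
  unfolding G_rels_def Ts_def[symmetric] Us_def[symmetric] by (auto simp: set_Ts set_Us)

lemma G_rels_cases:
  assumes "(l, r) \<in> G_rels m n"
  obtains "(l, r) \<in> cyclic_relations (S # Ts m)" | "(l, r) \<in> cyclic_relations (S # Us n)"
  | i j where "(l, r) \<in> cyclic_relations [T i, U j]" "i \<in> {1..m}" "j \<in> {1..n}"
  using assms unfolding G_rels_def Ts_def[symmetric] Us_def[symmetric] by auto

lemma proj_in_words:
  assumes "x \<in> G_gens m n"
  shows "proj_T m x \<in> words (G_gens m n)" "proj_U n x \<in> words (G_gens m n)"
    "proj_Z x \<in> words (G_gens m n)"
  using assms by (cases x; auto simp: G_gens_sets)+

text \<open>The relation on \<open>S\<close> and the \<open>T i\<close> has the trivial image P^-1
  P; in the other relations every \<open>U j\<close> disappears and only one letter is left.\<close>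

lemma pres_eq_proj_T:
  assumes "(l, r) \<in> G_rels m n"
  shows "pres_eq (G_gens m n) {} (substitute (proj_T m) l) (substitute (proj_T m) r)"
  using assms
proof (cases rule: G_rels_cases)
  case 1
  have "concat (map (proj_T m) (map T is)) = positive (map T is)" for "is"
    by (induction "is") auto
  then have "concat (map (proj_T m) (S # Ts m)) = inverse_word (positive (Ts m)) @ positive (Ts m)"
    by (simp add: Ts_def del: upt_Suc)
  then have "pres_eq (G_gens m n) {} (concat (map (proj_T m) (S # Ts m))) []"
    using pres_eq_left_inverse[of "positive (Ts m)" "G_gens m n"] by simp
  then show ?thesis by (rule pres_eq_substitute_cyclic_trivial[OF _ _ 1, rotated]) simp
next
  case 2
  then show ?thesis
    by (rule pres_eq_substitute_cyclic_single[rotated 2])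
      (auto simp: Us_def filter_map comp_def G_gens_sets simp del: upt_Suc)
next
  case 3
  then show ?thesis
    by (intro pres_eq_substitute_cyclic_single[OF _ _ 3(1)]) (auto simp: G_gens_def)
qed

lemma pres_eq_proj_U:
  assumes "(l, r) \<in> G_rels m n"
  shows "pres_eq (G_gens m n) {} (substitute (proj_U n) l) (substitute (proj_U n) r)"
  using assms
proof (cases rule: G_rels_cases)
  case 1
  then show ?thesis
    by (rule pres_eq_substitute_cyclic_single[rotated 2])
      (auto simp: Ts_def filter_map comp_def G_gens_sets simp del: upt_Suc)
next
  case 2
  have "concat (map (proj_U n) (map U js)) = positive (map U js)" for js
    by (induction js) auto
  then have "concat (map (proj_U n) (S # Us n)) = inverse_word (positive (Us n)) @ positive (Us n)"
    by (simp add: Us_def del: upt_Suc)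
  then have "pres_eq (G_gens m n) {} (concat (map (proj_U n) (S # Us n))) []"
    using pres_eq_left_inverse[of "positive (Us n)" "G_gens m n"] by simp
  then show ?thesis by (rule pres_eq_substitute_cyclic_trivial[OF _ _ 2, rotated]) simp
next
  case 3
  then show ?thesis
    by (intro pres_eq_substitute_cyclic_single[OF _ _ 3(1)]) (auto simp: G_gens_def)
qed

text \<open>Only \<open>S\<close> survives, and it occurs at most once in each cyclic word.\<close>

lemma pres_eq_proj_Z:
  assumes "(l, r) \<in> G_rels m n"
  shows "pres_eq (G_gens m n) {} (substitute proj_Z l) (substitute proj_Z r)"
  using assms
proof (cases rule: G_rels_cases)
  case 1
  then show ?thesis
    by (rule pres_eq_substitute_cyclic_single[rotated 2])
      (auto simp: Ts_def filter_map comp_def G_gens_def simp del: upt_Suc)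
next
  case 2
  then show ?thesis
    by (rule pres_eq_substitute_cyclic_single[rotated 2])
      (auto simp: Us_def filter_map comp_def G_gens_def simp del: upt_Suc)
next
  case 3
  then show ?thesis
    by (intro pres_eq_substitute_cyclic_single[OF _ _ 3(1)]) (auto simp: G_gens_def)
qed

section \<open>The central element and the direct product decomposition\<close>

context
  fixes m n :: nat
begin

private abbreviation (input) "gens \<equiv> G_gens m n"
private abbreviation (input) "rels \<equiv> G_rels m n"
private abbreviation (input) "P \<equiv> positive (Ts m)"
private abbreviation (input) "Q \<equiv> positive (Us n)"

lemma commute_T_U:
  assumes "v \<in> words (set (Ts m))" "w \<in> words (set (Us n))"
  shows "commute gens rels v w"
proof (rule commute_words[OF G_rels_in_words _ _ _ assms])
  show "commute gens rels [(t, True)] [(u, True)]" if "t \<in> set (Ts m)" "u \<in> set (Us n)" for t u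
    using pres_eq_cyclic[of "[t]" "[u]" rels gens] G_rels_cyclic(3)[OF that] that
    by (simp add: commute_def G_gens_sets)
qed (auto simp: G_gens_sets)

lemma P_Q_in_words: "P \<in> words (set (Ts m))" "Q \<in> words (set (Us n))" "P \<in> words gens" "Q \<in> words gens"
  by (auto simp: G_gens_sets)

lemma commute_S_P: "commute gens rels [(S, True)] P"
  using pres_eq_cyclic[of "[S]" "Ts m" rels gens] G_rels_cyclic(1)
  by (simp add: commute_def)

lemma commute_S_Q: "commute gens rels [(S, True)] Q"
  using pres_eq_cyclic[of "[S]" "Us n" rels gens] G_rels_cyclic(2)
  by (simp add: commute_def)

text \<open>Puts Q next to \<open>S\<close>, so that the cyclic relation on \<open>S\<close> and the
  \<open>U j\<close> becomes applicable to the central element.\<close>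

lemma central_eq: "pres_eq gens rels (central m n) (positive (S # Us n) @ P)"
  using pres_eq_append[OF commute_T_U[OF P_Q_in_words(1,2), unfolded commute_def], of "[(S, True)]" "[]"]
  by (simp add: central_def G_gens_sets)

text \<open>For \<open>S\<close> and the \<open>T i\<close>, split the element as (s P) Q: the
  cyclic relation handles s P, and Q commutes with the generator. For the \<open>U j\<close>, use
  the form (s Q) P instead.\<close>

lemma commute_central_generator:
  assumes "x \<in> gens"
  shows "commute gens rels [(x, True)] (central m n)"
proof -
  have "set (S # Ts m) \<subseteq> gens" "set (S # Us n) \<subseteq> gens" by (auto simp: G_gens_sets)
  note cyclic = commute_cyclic_product[OF G_rels_in_words G_rels_cyclic(1) this(1)]
    commute_cyclic_product[OF G_rels_in_words G_rels_cyclic(2) this(2)]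
  consider "x = S" | "x \<in> set (Ts m)" | "x \<in> set (Us n)" using assms by (auto simp: G_gens_sets)
  then show ?thesis
  proof cases
    case 1
    then show ?thesis
      unfolding central_def using cyclic(1)[of S] commute_S_Q
      by (intro commute_append[OF G_rels_in_words]) simp_all
  next
    case 2
    then show ?thesis
      unfolding central_def using cyclic(1)[of x] commute_T_U[of "[(x, True)]" Q]
      by (intro commute_append[OF G_rels_in_words]) simp_all
  next
    case 3
    then have "commute gens rels [(x, True)] P"
      using commute_sym[OF G_rels_in_words commute_T_U[of P "[(x, True)]"]] by simp
    then have "commute gens rels [(x, True)] (positive (S # Us n) @ P)"
      using 3 cyclic(2)[of x] by (intro commute_append[OF G_rels_in_words]) simp_all
    then show ?thesis
      using commute_cong[OF G_rels_in_words] pres_eq.sym[OF central_eq] by blast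
  qed
qed

lemma central_in_words: "central m n \<in> words gens"
  by (auto simp: central_def G_gens_sets)

lemma commute_central:
  assumes "w \<in> words gens"
  shows "commute gens rels w (central m n)"
proof (rule commute_sym[OF G_rels_in_words])
  show "commute gens rels (central m n) w"
    using commute_substitute_right[OF G_rels_in_words central_in_words _ assms,
        of "\<lambda>x. [(x, True)]"] commute_central_generator commute_sym[OF G_rels_in_words]
    by (simp add: substitute_generators)
qed

text \<open>Only \<open>S\<close> needs an argument: insert P^-1 P and Q^-1 Q to get s = P^-1 Q^-1
  (Q P s), where the bracket is the central element.\<close>

lemma generator_decomposition:
  assumes "x \<in> gens"
  shows "pres_eq gens rels [(x, True)]
    (proj_T m x @ proj_U n x @ substitute (\<lambda>_. central m n) (proj_Z x))"
proof (cases x)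
  case S
  note w = P_Q_in_words(3,4)
  have SS: "[(S, True)] \<in> words gens" by (simp add: G_gens_sets)
  have QPS: "pres_eq gens rels (Q @ P @ [(S, True)]) (central m n)"
  proof -
    have "commute gens rels [(S, True)] (Q @ P)"
      by (intro commute_append[OF G_rels_in_words] commute_S_P commute_S_Q)
    then have "pres_eq gens rels (Q @ P @ [(S, True)]) (positive (S # Us n) @ P)"
      using pres_eq.sym by (fastforce simp: commute_def)
    then show ?thesis using pres_eq.sym[OF central_eq] by (rule pres_eq.trans)
  qed
  note [trans] = pres_eq.trans
  have "pres_eq gens rels [(S, True)] (inverse_word P @ P @ [(S, True)])"
    using pres_eq_append[OF pres_eq.sym[OF pres_eq_left_inverse[OF w(1)]], of "[]" "[(S, True)]"] SS
    by simp
  also have "pres_eq gens rels (inverse_word P @ P @ [(S, True)])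
      (inverse_word P @ inverse_word Q @ Q @ P @ [(S, True)])"
    using pres_eq_append[OF pres_eq.sym[OF pres_eq_left_inverse[OF w(2)]],
      of "inverse_word P" "P @ [(S, True)]"] SS w by simp
  also have "pres_eq gens rels (inverse_word P @ inverse_word Q @ Q @ P @ [(S, True)])
      (inverse_word P @ inverse_word Q @ central m n)"
    using pres_eq_append[OF QPS, of "inverse_word P @ inverse_word Q" "[]"] w by simp
  finally show ?thesis using S by simp
qed (use assms in \<open>simp_all add: pres_eq.refl\<close>)

text \<open>Each letter is replaced by its three components, which are then sorted into blocks by
  two uses of \<open>substitute_append_pointwise\<close>. The required commutations are those
  between T-words and U-words and the centrality of z.\<close>

lemma word_decomposition:
  assumes w: "w \<in> words gens"
  shows "pres_eq gens rels w (substitute (proj_T m) w @ substitute (proj_U n) w @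
    substitute (\<lambda>_. central m n) (substitute proj_Z w))"
proof -
  let ?z = "\<lambda>x. substitute (\<lambda>_. central m n) (proj_Z x)"
  have TU: "commute gens rels (proj_T m x) (proj_U n y)" if "x \<in> gens" "y \<in> gens" for x y
    using that by (intro commute_T_U) (cases x; cases y; auto simp: G_gens_def set_Ts set_Us)+
  have z: "commute gens rels v (?z y)" if "v \<in> words gens" for v y
    using commute_central[OF that] that
    by (cases y) (simp_all add: commute_Nil[OF G_rels_in_words])
  note [trans] = pres_eq.trans
  have "pres_eq gens rels (substitute (\<lambda>x. proj_U n x @ ?z x) w)
      (substitute (proj_U n) w @ substitute ?z w)"
    using w by (intro substitute_append_pointwise[OF G_rels_in_words] z proj_in_words)
  then have UZ: "pres_eq gens rels (substitute (proj_T m) w @ substitute (\<lambda>x. proj_U n x @ ?z x) w)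
      (substitute (proj_T m) w @ substitute (proj_U n) w @ substitute ?z w)"
    using pres_eq_append[of gens rels _ _ "substitute (proj_T m) w" "[]"]
      substitute_in_words[OF w proj_in_words(1)] by simp
  \<comment> \<open>The word \<open>w\<close> is viewed as the identity substitution applied to
    itself, so that its letters can be replaced one by one.\<close>
  have "pres_eq gens rels w (substitute (\<lambda>x. proj_T m x @ proj_U n x @ ?z x) w)"
    using substitute_pointwise_cong[where f = "\<lambda>x. [(x, True)]"
        and g = "\<lambda>x. proj_T m x @ proj_U n x @ ?z x", OF G_rels_in_words _ w] generator_decomposition
    by (simp add: substitute_generators)
  also have "pres_eq gens rels (substitute (\<lambda>x. proj_T m x @ proj_U n x @ ?z x) w)
      (substitute (proj_T m) w @ substitute (\<lambda>x. proj_U n x @ ?z x) w)"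
    using w by (intro substitute_append_pointwise[OF G_rels_in_words]
      commute_append[OF G_rels_in_words] TU z proj_in_words)
  also note UZ
  finally show ?thesis unfolding substitute_substitute .
qed

text \<open>Forwards, the projections are homomorphisms. Backwards,
  \<open>word_decomposition\<close> rebuilds a word from its three projections, so freely equal
  projections force equality in the group.\<close>

lemma pres_eq_iff_projections:
  assumes "v \<in> words gens" "w \<in> words gens"
  shows "pres_eq gens rels v w \<longleftrightarrow>
    (\<forall>h\<in>set [proj_T m, proj_U n, proj_Z]. pres_eq gens {} (substitute h v) (substitute h w))"
    (is "_ \<longleftrightarrow> ?free")
proof
  assume "pres_eq gens rels v w"
  note vw = pres_eq_substitute[OF _ _ _ this, of "{}" gens, simplified]
  show ?free
    using vw[OF proj_in_words(1) pres_eq_proj_T] vw[OF proj_in_words(2) pres_eq_proj_U]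
      vw[OF proj_in_words(3) pres_eq_proj_Z] by simp
next
  let ?z = "substitute (\<lambda>_. central m n)"
  assume ?free
  then have eq: "pres_eq gens {} (substitute (proj_T m) v) (substitute (proj_T m) w)"
      "pres_eq gens {} (substitute (proj_U n) v) (substitute (proj_U n) w)"
      "pres_eq gens {} (substitute proj_Z v) (substitute proj_Z w)"
    by simp_all
  \<comment> \<open>Sending the free generator z to the central word turns free equality into
    equality in the group.\<close>
  have "pres_eq gens rels (?z (substitute proj_Z v)) (?z (substitute proj_Z w))"
    using pres_eq_substitute[OF G_rels_in_words _ _ eq(3), of "\<lambda>_. central m n"] central_in_words
    by simp
  then have "pres_eq gens rels
      (substitute (proj_T m) v @ substitute (proj_U n) v @ ?z (substitute proj_Z v))
      (substitute (proj_T m) w @ substitute (proj_U n) w @ ?z (substitute proj_Z w))"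
    by (intro pres_eq_cong[OF G_rels_in_words] pres_eq_free_imp[OF eq(1)] pres_eq_free_imp[OF eq(2)])
  with word_decomposition[OF assms(1)]
  have "pres_eq gens rels v
      (substitute (proj_T m) w @ substitute (proj_U n) w @ ?z (substitute proj_Z w))"
    by (rule pres_eq.trans)
  then show "pres_eq gens rels v w"
    using pres_eq.sym[OF word_decomposition[OF assms(2)]] by (rule pres_eq.trans)
qed

end

theorem proposition5p2:
  fixes m n :: nat
  assumes "m \<ge> 2" and "n \<ge> 2"
  shows "word_problem_solvable gen_num (G_gens m n) (G_rels m n)"
proof (rule word_problem_solvable_if_free_equality[OF inj_gen_num _ _ pres_eq_iff_projections])
  show "finite (G_gens m n)" by (simp add: G_gens_def)
qed (auto intro: proj_in_words)

end
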